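(* Derivative cones of spectrahedral cones do not in general satisfy the generalized Lax conjecture. That is, there exist positive integers $n, d$, real symmetric matrices $A_1,\dots,A_n \in \mathbb{R}^{d\times d}$, a point $\mathbf{e}\in\mathbb{R}^n$ with $e_1A_1+\cdots+e_nA_n$ positive definite, and an integer $i$ with $1\le i\le d-1$, such that for the hyperbolic polynomial $p(\mathbf{x})=\det(x_1A_1+\cdots+x_nA_n)$ the $i$-th polar $R^i_{\mathbf{e}}p$ does not have a definite determinantal representation with respect to $\mathbf{e}$: there are no real symmetric matrices $B_1,\dots,B_n$ of order $d-i$ such that $e_1B_1+\cdots+e_nB_n$ is positive definite and \[ R^i_{\mathbf{e}}p(\mathbf{x}) = \det(x_1B_1+x_2B_2+\cdots+x_nB_n). \]
   Context: A homogeneous polynomial $q \in \mathbb{R}[x_1,\dots,x_n]$ is hyperbolic with respect to $\mathbf{e}\in\mathbb{R}^n$ if $q(\mathbf{e})>0$ and for every $\mathbf{v}\in\mathbb{R}^n$ the univariate polynomial $\lambda\mapsto q(\mathbf{v}+\lambda\mathbf{e})$ has only real roots. Its hyperbolicity cone $\Lambda_{q,\mathbf{e}}$ is the closure of the connected component of $\mathbb{R}^n\setminus\{\mathbf{x} : q(\mathbf{x})=0\}$ containing $\mathbf{e}$. A spectrahedral cone is a set $\{\mathbf{x}\in\mathbb{R}^n : x_1A_1+\cdots+x_nA_n\succeq 0\}$ with $A_1,\dots,A_n$ real symmetric matrices; if $e_1A_1+\cdots+e_nA_n$ is positive definite, it is the hyperbolicity cone of $p(\mathbf{x})=\det(x_1A_1+\cdots+x_nA_n)$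 with respect to $\mathbf{e}$. The $i$-th polar of $p$ with respect to $\mathbf{e}$ is, up to a positive constant factor (irrelevant here), the $i$-th directional derivative \[ R^i_{\mathbf{e}}p(\mathbf{x}) = \frac{d^i}{dt^i}\,p(\mathbf{x}+t\mathbf{e})\Big|_{t=0} ; \] it is homogeneous of degree $\deg p-i$ and again hyperbolic with respect to $\mathbf{e}$, and its hyperbolicity cone is the $i$-th derivative cone $\Lambda^i_{p,\mathbf{e}}$ of $(p,\mathbf{e})$. A hyperbolic polynomial $q$ (with respect to $\mathbf{e}$) is said to satisfy the generalized Lax conjecture if $q(\mathbf{x})=\det(x_1B_1+\cdots+x_nB_n)$ for some real symmetric matrices $B_1,\dots,B_n$ with $e_1B_1+\cdots+e_nB_n$ positive definite (the order of the $B_j$ is then necessarily $\deg q$). *)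

theory Defs
  imports "HOL-Analysis.Derivative" "Jordan_Normal_Form.Determinant"
begin

(* Variables are numbered from 0, so a point x in R^n has coordinates x $ 0, ..., x $ (n - 1).
   The dimension is explicit because JNF matrices of a varying size do not form a monoid type,
   hence the entrywise sum. *)
definition pencil :: "nat \<Rightarrow> nat \<Rightarrow> (nat \<Rightarrow> real mat) \<Rightarrow> real vec \<Rightarrow> real mat" where
  "pencil n d A x = mat d d (\<lambda>(r, c). \<Sum>k<n. x $ k * A k $$ (r, c))"

definition symmetric_mat :: "nat \<Rightarrow> real mat \<Rightarrow> bool" where
  "symmetric_mat d M \<longleftrightarrow> M \<in> carrier_mat d d \<and> M\<^sup>T = M"

definition positive_definite :: "nat \<Rightarrow> real mat \<Rightarrow> bool" where
  "positive_definite d M \<longleftrightarrow> symmetric_mat d M \<and>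
     (\<forall>v \<in> carrier_vec d. v \<noteq> 0\<^sub>v d \<longrightarrow> v \<bullet> (M *\<^sub>v v) > 0)"

(* Polynomials are represented by their functions on R^n, which determine them as R is infinite. *)
definition polar :: "nat \<Rightarrow> real vec \<Rightarrow> (real vec \<Rightarrow> real) \<Rightarrow> real vec \<Rightarrow> real" where
  "polar i e p x = (deriv ^^ i) (\<lambda>t. p (x + t \<cdot>\<^sub>v e)) 0"

definition definite_det_rep :: "nat \<Rightarrow> nat \<Rightarrow> real vec \<Rightarrow> (real vec \<Rightarrow> real) \<Rightarrow> bool" where
  "definite_det_rep n m e q \<longleftrightarrow>
     (\<exists>B. (\<forall>k<n. symmetric_mat m (B k)) \<and>
          positive_definite m (pencil n m B e) \<and>
          (\<forall>x \<in> carrier_vec n. q x = det (pencil n m B x)))"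

end

theory Submission
  imports Defs
begin

text \<open>The second polar of \<open>x\<^sub>0x\<^sub>1x\<^sub>2x\<^sub>3\<close> along \<open>(1,1,1,1)\<close> is twice the elementary symmetric
  polynomial of degree 2, a nondegenerate quadratic form in four variables. Real symmetric
  \<open>2 \<times> 2\<close> matrices form a space of dimension 3, so in any determinantal representation the four
  coefficient matrices are linearly dependent, and the form would be invariant under translation
  by a nonzero vector.\<close>

unbundle no vec_syntax

text \<open>Chosen so that the pencil is the diagonal matrix of the coordinates: its determinant is
  their product, and at the all-ones vector it is the identity.\<close>

definition unit_entry_mat :: "nat \<Rightarrow> nat \<Rightarrow> real mat" where
  "unit_entry_mat n k = mat n n (\<lambda>(r, c). if r = k \<and> c = k then 1 else 0)"

lemma symmetric_mat_unit_entry_mat: "symmetric_mat n (unit_entry_mat n k)"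
  by (auto simp: symmetric_mat_def unit_entry_mat_def)

lemma pencil_unit_entry_mat:
  "pencil n n (unit_entry_mat n) x = mat n n (\<lambda>(r, c). if r = c then x $ r else 0)"
proof (intro eq_matI)
  fix r c
  assume "r < dim_row (mat n n (\<lambda>(r, c). if r = c then x $ r else 0))"
    and "c < dim_col (mat n n (\<lambda>(r, c). if r = c then x $ r else 0))"
  then have r: "r < n" and c: "c < n" by simp_all
  have "pencil n n (unit_entry_mat n) x $$ (r, c) =
      (\<Sum>k<n. x $ k * (if r = k \<and> c = k then 1 else 0))"
    using r c by (simp add: pencil_def unit_entry_mat_def)
  also have "\<dots> = (\<Sum>k<n. if k = r then (if r = c then x $ r else 0) else 0)"
    by (intro sum.cong) auto
  also have "\<dots> = (if r = c then x $ r else 0)"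
    using r by simp
  finally show "pencil n n (unit_entry_mat n) x $$ (r, c) =
      mat n n (\<lambda>(r, c). if r = c then x $ r else 0) $$ (r, c)"
    using r c by simp
qed (simp_all add: pencil_def)

lemma det_pencil_unit_entry_mat: "det (pencil n n (unit_entry_mat n) x) = (\<Prod>k<n. x $ k)"
proof -
  let ?M = "pencil n n (unit_entry_mat n) x"
  have "det ?M = prod_list (diag_mat ?M)"
    by (intro det_upper_triangular[where n = n])
      (auto simp: pencil_unit_entry_mat upper_triangular_def)
  also have "\<dots> = (\<Prod>k<n. x $ k)"
    by (simp add: prod_list_diag_prod pencil_unit_entry_mat atLeast0LessThan)
  finally show ?thesis .
qed

lemma positive_definite_one_mat: "positive_definite n (1\<^sub>m n)"
proof -
  have "v \<bullet> v > 0" if v: "v \<in> carrier_vec n" "v \<noteq> 0\<^sub>v n" for v :: "real vec"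
  proof -
    obtain k where "k < n" "v $ k \<noteq> 0"
      using v by (metis carrier_vecD eq_vecI index_zero_vec)
    then have "(\<Sum>k = 0..<n. v $ k * v $ k) > 0"
      by (intro sum_pos2[of _ k]) (auto simp: zero_less_mult_iff)
    then show ?thesis
      using v by (simp add: scalar_prod_def)
  qed
  then show ?thesis
    by (auto simp: positive_definite_def symmetric_mat_def)
qed

text \<open>Padding the \<open>m\<close> equations with zero rows gives a square singular matrix,
  and any nonzero kernel vector of it solves the system.\<close>

lemma underdetermined_nontrivial_solution:
  fixes f :: "nat \<Rightarrow> nat \<Rightarrow> 'a :: field"
  assumes "m < n"
  obtains c where "c \<in> carrier_vec n" "c \<noteq> 0\<^sub>v n" "\<And>r. r < m \<Longrightarrow> (\<Sum>k<n. c $ k * f r k) = 0"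
proof -
  define M where "M = mat n n (\<lambda>(r, k). if r < m then f r k else 0)"
  have M: "M \<in> carrier_mat n n"
    by (simp add: M_def)
  \<comment> \<open>Row \<open>m\<close> exists because \<open>m < n\<close>, and it is the first
    padded zero row, so expanding along it gives determinant 0.\<close>
  have "det M = (\<Sum>k<n. M $$ (m, k) * cofactor M m k)"
    using M assms by (rule laplace_expansion_row)
  also have "\<dots> = 0"
    using assms by (simp add: M_def)
  finally obtain c where c: "c \<in> carrier_vec n" "c \<noteq> 0\<^sub>v n" "M *\<^sub>v c = 0\<^sub>v n"
    using det_0_iff_vec_prod_zero[OF M] by blast
  have "(\<Sum>k<n. c $ k * f r k) = 0" if "r < m" for r
  proof -
    have "(M *\<^sub>v c) $ r = (\<Sum>k<n. c $ k * f r k)"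
      using that assms c(1)
      by (auto simp: M_def scalar_prod_def atLeast0LessThan intro!: sum.cong)
    then show ?thesis
      using c(3) that assms by simp
  qed
  with c that show ?thesis by blast
qed

lemma symmetric_mat_index:
  assumes "symmetric_mat m M" "r < m" "c < m"
  shows "M $$ (r, c) = M $$ (c, r)"
proof -
  have "M\<^sup>T $$ (r, c) = M $$ (c, r)"
    using assms by (intro index_transpose_mat) (auto simp: symmetric_mat_def)
  then show ?thesis
    using assms(1) by (simp add: symmetric_mat_def)
qed

text \<open>A symmetric matrix of order 2 is determined by its entries (0,0), (0,1) and (1,1), so
  the vanishing of the pencil amounts to three linear equations in more than three unknowns.\<close>

lemma pencil_kernel_of_symmetric_mat2:
  assumes "n > 3" and sym: "\<And>k. k < n \<Longrightarrow> symmetric_mat 2 (B k)"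
  obtains c where "c \<in> carrier_vec n" "c \<noteq> 0\<^sub>v n" "pencil n 2 B c = 0\<^sub>m 2 2"
proof -
  obtain c where c: "c \<in> carrier_vec n" "c \<noteq> 0\<^sub>v n"
    and sum0: "\<And>r. r < 3 \<Longrightarrow> (\<Sum>k<n. c $ k * B k $$ ([(0, 0), (0, 1), (1, 1)] ! r)) = 0"
    using underdetermined_nontrivial_solution[OF assms(1),
        where f = "\<lambda>r k. B k $$ ([(0, 0), (0, 1), (1, 1)] ! r)"] by blast
  \<comment> \<open>The remaining entry (1,0) vanishes by symmetry.\<close>
  have "(\<Sum>k<n. c $ k * B k $$ (1, 0)) = (\<Sum>k<n. c $ k * B k $$ (0, 1))"
    using symmetric_mat_index[OF sym] by (intro sum.cong) auto
  then have "pencil n 2 B c = 0\<^sub>m 2 2"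
    using sum0[of 0] sum0[of 1] sum0[of 2]
    by (intro eq_matI) (auto simp: pencil_def less_2_cases_iff)
  with c that show ?thesis by blast
qed

text \<open>By linearity of the pencil in the point; hence its determinant is invariant under
  translation by \<open>c\<close>.\<close>

lemma pencil_add_kernel:
  assumes x: "x \<in> carrier_vec n" and c: "c \<in> carrier_vec n" and "pencil n d B c = 0\<^sub>m d d"
  shows "pencil n d B (x + c) = pencil n d B x"
proof (intro eq_matI)
  fix i j
  assume "i < dim_row (pencil n d B x)" "j < dim_col (pencil n d B x)"
  then have ij: "i < d" "j < d" by (simp_all add: pencil_def)
  have "(\<Sum>k<n. c $ k * B k $$ (i, j)) = pencil n d B c $$ (i, j)"
    using ij by (simp add: pencil_def)
  also have "\<dots> = 0"
    using ij assms(3) by simp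
  finally show "pencil n d B (x + c) $$ (i, j) = pencil n d B x $$ (i, j)"
    using ij x c by (simp add: pencil_def distrib_right sum.distrib)
qed (simp_all add: pencil_def)

lemma polar_prod4:
  assumes x: "x \<in> carrier_vec 4"
  shows "polar 2 (vec 4 (\<lambda>_. 1)) (\<lambda>x. \<Prod>k<4. x $ k) x =
    2 * (x $ 0 * x $ 1 + x $ 0 * x $ 2 + x $ 0 * x $ 3 + x $ 1 * x $ 2 + x $ 1 * x $ 3 + x $ 2 * x $ 3)"
proof -
  define a b c d where "a = x $ 0" and "b = x $ 1" and "c = x $ 2" and "d = x $ 3"
  have "(\<lambda>t. \<Prod>k<4. (x + t \<cdot>\<^sub>v vec 4 (\<lambda>_. 1)) $ k) = (\<lambda>t. (a + t) * (b + t) * (c + t) * (d + t))"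
    using x by (simp add: a_def b_def c_def d_def numeral_eq_Suc)
  \<comment> \<open>The product rule for \<open>(a + t) * (b + t)\<close> times
    \<open>(c + t) * (d + t)\<close>. The first derivative is needed as a function of
    \<open>t\<close>, the second only at 0.\<close>
  moreover have "deriv (\<lambda>t. (a + t) * (b + t) * (c + t) * (d + t)) =
    (\<lambda>t. ((b + t) + (a + t)) * (c + t) * (d + t) + (a + t) * (b + t) * ((d + t) + (c + t)))"
    by (intro ext DERIV_imp_deriv) (auto intro!: derivative_eq_intros simp: algebra_simps)
  moreover have "deriv (\<lambda>t. ((b + t) + (a + t)) * (c + t) * (d + t)
      + (a + t) * (b + t) * ((d + t) + (c + t))) 0 = 2 * (a*b + a*c + a*d + b*c + b*d + c*d)"
    by (intro DERIV_imp_deriv) (auto intro!: derivative_eq_intros simp: algebra_simps)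
  ultimately show ?thesis
    by (simp add: polar_def numeral_2_eq_2 a_def b_def c_def d_def)
qed

theorem theorem1p3:
  shows "\<exists>(n::nat) (d::nat) (A :: nat \<Rightarrow> real mat) (e :: real vec) (i::nat).
     1 \<le> n \<and> 1 \<le> d \<and>
     (\<forall>k<n. symmetric_mat d (A k)) \<and>
     e \<in> carrier_vec n \<and>
     positive_definite d (pencil n d A e) \<and>
     1 \<le> i \<and> i \<le> d - 1 \<and>
     \<not> definite_det_rep n (d - i) e (polar i e (\<lambda>x. det (pencil n d A x)))"
proof -
  define e :: "real vec" where "e = vec 4 (\<lambda>_. 1)"
  define q where "q = polar 2 e (\<lambda>x. det (pencil 4 4 (unit_entry_mat 4) x))"
  have q: "q x = 2 * (x $ 0 * x $ 1 + x $ 0 * x $ 2 + x $ 0 * x $ 3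
      + x $ 1 * x $ 2 + x $ 1 * x $ 3 + x $ 2 * x $ 3)" if "x \<in> carrier_vec 4" for x
    using polar_prod4[OF that] by (simp add: q_def e_def det_pencil_unit_entry_mat)
  have "\<not> definite_det_rep 4 2 e q"
  proof
    assume "definite_det_rep 4 2 e q"
    then obtain B where sym: "\<And>k. k < 4 \<Longrightarrow> symmetric_mat 2 (B k)"
      and rep: "\<And>x. x \<in> carrier_vec 4 \<Longrightarrow> q x = det (pencil 4 2 B x)"
      unfolding definite_det_rep_def by blast
    obtain c where c: "c \<in> carrier_vec 4" "c \<noteq> 0\<^sub>v 4" "pencil 4 2 B c = 0\<^sub>m 2 2"
      using pencil_kernel_of_symmetric_mat2[of 4 B] sym by auto
    have inv: "q (x + c) = q x" if "x \<in> carrier_vec 4" for x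
      using that c by (simp add: rep pencil_add_kernel)
    \<comment> \<open>The first equation gives \<open>q c = 0\<close>. Since \<open>q\<close>
      vanishes at each unit vector, the one for index k then leaves only the bilinear part: the
      coordinates of \<open>c\<close> other than the k-th sum to 0. Adding the four shows that the
      total is 0, so every coordinate, being the total minus the other three, is 0.\<close>
    have "q (0\<^sub>v 4 + c) = q (0\<^sub>v 4)" "q (unit_vec 4 0 + c) = q (unit_vec 4 0)"
      "q (unit_vec 4 1 + c) = q (unit_vec 4 1)" "q (unit_vec 4 2 + c) = q (unit_vec 4 2)"
      "q (unit_vec 4 3 + c) = q (unit_vec 4 3)"
      by (intro inv; simp)+
    then have "c $ 0 = 0 \<and> c $ 1 = 0 \<and> c $ 2 = 0 \<and> c $ 3 = 0"
      using c(1) by (simp add: q algebra_simps)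
    then have "c = 0\<^sub>v 4"
      using c(1) by (intro eq_vecI) (auto simp: less_Suc_eq numeral_eq_Suc)
    with c(2) show False by contradiction
  qed
  moreover have "pencil 4 4 (unit_entry_mat 4) e = 1\<^sub>m 4"
    by (intro eq_matI) (auto simp: pencil_unit_entry_mat e_def)
  ultimately show ?thesis
    using symmetric_mat_unit_entry_mat positive_definite_one_mat
    \<comment> \<open>The witness 4 serves both as the number of variables and as the order of the
      matrices; with \<open>i = 2\<close> the representation would have order 4 - 2 = 2.\<close>
    by (intro exI[of _ "4::nat"] exI[of _ "unit_entry_mat 4"] exI[of _ e] exI[of _ "2::nat"])
      (simp add: q_def e_def)
qed

end
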